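(* The tolerant learning hierarchy $\mathsf{TLH}$ is not an upper semilattice. In fact, there are equivalence relations $E^{\mathrm{ce}}$ and $F^{\mathrm{ce}}$ on $\omega$ extending $=^{\mathrm{ce}}$ such that the set $$\bigl\{[D^{\mathrm{ce}}]_{\equiv_{\mathrm{Learn}}}:\ D^{\mathrm{ce}}\in\mathcal{R}^{\mathrm{ce}},\ E^{\mathrm{ce}}\leq_{\mathrm{Learn}}D^{\mathrm{ce}}\text{ and }F^{\mathrm{ce}}\leq_{\mathrm{Learn}}D^{\mathrm{ce}}\bigr\}$$ has no minimal element.
   Context: Fix a standard (acceptable) enumeration $(\varphi_e)_{e\in\omega}$ of the partial computable functions and let $W_e=\operatorname{dom}(\varphi_e)$. Write $e=^{\mathrm{ce}}e'$ iff $W_e=W_{e'}$. Let $\mathcal{R}^{\mathrm{ce}}$ be the set of all equivalence relations on $\omega$ extending $=^{\mathrm{ce}}$ (no definability or effectivity is assumed). An enumeration of a set $A$ is a surjection $\mu:\omega\to A$; $\mu[s]$ denotes the finite string $\mu(0),\dots,\mu(s-1)$. A learner is an arbitrary function $\mathbf{M}:\omega^{<\omega}\to\omega$ (no effectivity is assumed). For $E^{\mathrm{ce}}\in\mathcal{R}^{\mathrm{ce}}$, a family $\mathfrak{K}$ of nonempty c.e. sets is $E^{\mathrm{ce}}$-learnable if there is a learner $\mathbf{M}$ such that for every $e$ with $W_e\in\mathfrak{K}$ and every enumeration $\mu$ of $W_e$ there is $i\in\omega$ with $i\mathrel{E^{\mathrm{ce}}}e$ and $\mathbf{M}(\mu[s])=i$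 for all sufficiently large $s$. $E^{\mathrm{ce}}\leq_{\mathrm{Learn}}F^{\mathrm{ce}}$ means that every $E^{\mathrm{ce}}$-learnable family of nonempty c.e. sets is also $F^{\mathrm{ce}}$-learnable; $E^{\mathrm{ce}}\equiv_{\mathrm{Learn}}F^{\mathrm{ce}}$ means both $E^{\mathrm{ce}}\leq_{\mathrm{Learn}}F^{\mathrm{ce}}$ and $F^{\mathrm{ce}}\leq_{\mathrm{Learn}}E^{\mathrm{ce}}$. The tolerant learning hierarchy $\mathsf{TLH}$ is the poset $(\mathcal{E}^{\mathrm{ce}},\leq)$ where $\mathcal{E}^{\mathrm{ce}}=\mathcal{R}^{\mathrm{ce}}/{\equiv_{\mathrm{Learn}}}$ and $\leq$ is induced by $\leq_{\mathrm{Learn}}$. An upper semilattice is a poset in which any two elements have a least upper bound. *)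

theory Defs
  imports "HOL-Algebra.Lattice"
begin

section \<open>Partial computable functions and acceptable enumerations\<close>

datatype recf =
    Zero
  | Succ
  | Proj nat
  | Comp recf "recf list"
  | Prec recf recf
  | Mu recf

text \<open>
  Call-by-value big-step semantics of Kleene's \<open>\<mu>\<close>-recursive schemes; \<open>recf_eval p xs y\<close> says that
  \<open>p\<close> halts on \<open>xs\<close> with value \<open>y\<close>. Arities are not tracked: a scheme applied to an argument list
  that is too short diverges, and superfluous arguments of \<open>Zero\<close>, \<open>Succ\<close>, \<open>Proj\<close> are ignored, so
  on lists of any fixed length a scheme still defines a partial recursive function. In \<open>Prec\<close>
  and \<open>Mu\<close> the recursion, respectively search, variable comes first; \<open>Mu p\<close> requires \<open>p\<close> to be
  defined and nonzero below the returned value.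
\<close>

inductive recf_eval :: "recf \<Rightarrow> nat list \<Rightarrow> nat \<Rightarrow> bool" where
  zero: "recf_eval Zero xs 0"
| succ: "recf_eval Succ (x # xs) (Suc x)"
| proj: "i < length xs \<Longrightarrow> recf_eval (Proj i) xs (xs ! i)"
| comp: "list_all2 (\<lambda>q y. recf_eval q xs y) qs ys \<Longrightarrow> recf_eval p ys z \<Longrightarrow> recf_eval (Comp p qs) xs z"
| prec_0: "recf_eval p xs y \<Longrightarrow> recf_eval (Prec p q) (0 # xs) y"
| prec_Suc: "recf_eval (Prec p q) (n # xs) y \<Longrightarrow> recf_eval q (n # y # xs) z
    \<Longrightarrow> recf_eval (Prec p q) (Suc n # xs) z"
| mu: "recf_eval p (n # xs) 0 \<Longrightarrow> (\<forall>m<n. \<exists>y>0. recf_eval p (m # xs) y) \<Longrightarrow> recf_eval (Mu p) xs n"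

lemma recf_eval_deterministic: "recf_eval p xs y \<Longrightarrow> recf_eval p xs z \<Longrightarrow> y = z"
proof (induction arbitrary: z rule: recf_eval.induct)
  case (comp xs qs ys p z')
  from comp.prems obtain ys' where ys': "list_all2 (\<lambda>q y. recf_eval q xs y) qs ys'" "recf_eval p ys' z"
    by cases
  have "ys = ys'"
    using comp.IH(1) ys'(1) by (auto simp: list_all2_conv_all_nth intro!: nth_equalityI)
  with ys'(2) comp.IH(2) show ?case by blast
next
  case (prec_Suc p q n xs y z')
  from prec_Suc.prems obtain y' where "recf_eval (Prec p q) (n # xs) y'" "recf_eval q (n # y' # xs) z"
    by cases
  with prec_Suc.IH show ?case by blast
next
  case (mu p n xs)
  from mu.prems have z: "recf_eval p (z # xs) 0" "\<forall>m<z. \<exists>y>0. recf_eval p (m # xs) y"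
    by (cases, blast)+
  show ?case
  proof (cases n z rule: linorder_cases)
    case less
    with z(2) mu.IH(1) show ?thesis by (metis less_irrefl)
  next
    case greater
    with z(1) mu.IH(2) show ?thesis by (metis less_irrefl)
  qed
next
  case (prec_0 p xs y q)
  from prec_0.prems have "recf_eval p xs z" by cases
  with prec_0.IH show ?case by blast
qed (erule recf_eval.cases; simp)+

definition partial_computable :: "(nat \<Rightarrow> nat option) \<Rightarrow> bool" where
  "partial_computable f \<longleftrightarrow> (\<exists>p. \<forall>x y. f x = Some y \<longleftrightarrow> recf_eval p [x] y)"

definition partial_computable2 :: "(nat \<Rightarrow> nat \<Rightarrow> nat option) \<Rightarrow> bool" where
  "partial_computable2 f \<longleftrightarrow> (\<exists>p. \<forall>e x y. f e x = Some y \<longleftrightarrow> recf_eval p [e, x] y)"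

definition computable :: "(nat \<Rightarrow> nat) \<Rightarrow> bool" where
  "computable f \<longleftrightarrow> partial_computable (\<lambda>x. Some (f x))"

text \<open>
  An enumeration of exactly the unary partial computable functions that has a partial computable
  universal function and satisfies the s-m-n property. By Rogers' theorem these are the
  enumerations that are computably intertranslatable with the standard one.
\<close>

definition acceptable_enumeration :: "(nat \<Rightarrow> nat \<Rightarrow> nat option) \<Rightarrow> bool" where
  "acceptable_enumeration \<phi> \<longleftrightarrow>
     range \<phi> = {f. partial_computable f} \<and>
     partial_computable2 \<phi> \<and>
     (\<forall>\<psi>. partial_computable2 \<psi> \<longrightarrow> (\<exists>t. computable t \<and> (\<forall>e. \<phi> (t e) = \<psi> e)))"

section \<open>Learning up to an equivalence relation\<close>

definition W :: "(nat \<Rightarrow> nat \<Rightarrow> nat option) \<Rightarrow> nat \<Rightarrow> nat set" where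
  "W \<phi> e = dom (\<phi> e)"

definition eq_ce :: "(nat \<Rightarrow> nat \<Rightarrow> nat option) \<Rightarrow> nat rel" where
  "eq_ce \<phi> = {(e, e'). W \<phi> e = W \<phi> e'}"

definition R_ce :: "(nat \<Rightarrow> nat \<Rightarrow> nat option) \<Rightarrow> nat rel set" where
  "R_ce \<phi> = {E. equiv UNIV E \<and> eq_ce \<phi> \<subseteq> E}"

definition nonempty_ce_sets :: "(nat \<Rightarrow> nat \<Rightarrow> nat option) \<Rightarrow> nat set set" where
  "nonempty_ce_sets \<phi> = {A. A \<noteq> {} \<and> (\<exists>e. A = W \<phi> e)}"

definition enumeration_of :: "(nat \<Rightarrow> nat) \<Rightarrow> nat set \<Rightarrow> bool" where
  "enumeration_of \<mu> A \<longleftrightarrow> range \<mu> = A"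

definition initial_segment :: "(nat \<Rightarrow> nat) \<Rightarrow> nat \<Rightarrow> nat list" where
  "initial_segment \<mu> s = map \<mu> [0..<s]"

definition learnable :: "(nat \<Rightarrow> nat \<Rightarrow> nat option) \<Rightarrow> nat rel \<Rightarrow> nat set set \<Rightarrow> bool" where
  "learnable \<phi> E K \<longleftrightarrow>
     (\<exists>M :: nat list \<Rightarrow> nat. \<forall>e \<mu>. W \<phi> e \<in> K \<and> enumeration_of \<mu> (W \<phi> e) \<longrightarrow>
        (\<exists>i. (i, e) \<in> E \<and> (\<forall>\<^sub>F s in sequentially. M (initial_segment \<mu> s) = i)))"

definition le_Learn :: "(nat \<Rightarrow> nat \<Rightarrow> nat option) \<Rightarrow> nat rel \<Rightarrow> nat rel \<Rightarrow> bool" where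
  "le_Learn \<phi> E F \<longleftrightarrow> (\<forall>K \<subseteq> nonempty_ce_sets \<phi>. learnable \<phi> E K \<longrightarrow> learnable \<phi> F K)"

definition equiv_Learn :: "(nat \<Rightarrow> nat \<Rightarrow> nat option) \<Rightarrow> nat rel rel" where
  "equiv_Learn \<phi> = {(E, F). E \<in> R_ce \<phi> \<and> F \<in> R_ce \<phi> \<and> le_Learn \<phi> E F \<and> le_Learn \<phi> F E}"

definition TLH :: "(nat \<Rightarrow> nat \<Rightarrow> nat option) \<Rightarrow> nat rel set gorder" where
  "TLH \<phi> = \<lparr> carrier = R_ce \<phi> // equiv_Learn \<phi>, eq = (=),
             le = (\<lambda>a b. \<exists>E\<in>a. \<exists>F\<in>b. le_Learn \<phi> E F) \<rparr>"

lemma le_Learn_refl: "le_Learn \<phi> E E"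
  by (simp add: le_Learn_def)

lemma le_Learn_trans: "le_Learn \<phi> D E \<Longrightarrow> le_Learn \<phi> E F \<Longrightarrow> le_Learn \<phi> D F"
  by (simp add: le_Learn_def)

lemma equiv_equiv_Learn: "equiv (R_ce \<phi>) (equiv_Learn \<phi>)"
  by (intro equivI refl_onI symI transI)
    (auto simp: equiv_Learn_def intro: le_Learn_refl le_Learn_trans)

lemma carrier_TLH: "carrier (TLH \<phi>) = {equiv_Learn \<phi> `` {E} | E. E \<in> R_ce \<phi>}"
  by (auto simp: TLH_def quotient_def)

lemma le_TLH_iff:
  assumes "E \<in> R_ce \<phi>" "F \<in> R_ce \<phi>"
  shows "equiv_Learn \<phi> `` {E} \<sqsubseteq>\<^bsub>TLH \<phi>\<^esub> equiv_Learn \<phi> `` {F} \<longleftrightarrow> le_Learn \<phi> E F"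
  using assms by (auto simp: TLH_def equiv_Learn_def intro: le_Learn_refl le_Learn_trans)

lemma partial_order_TLH: "partial_order (TLH \<phi>)"
proof -
  have eq: "eq (TLH \<phi>) = (=)" by (simp add: TLH_def)
  show ?thesis
  proof (unfold_locales, simp_all only: eq)
    fix x y assume *: "x \<sqsubseteq>\<^bsub>TLH \<phi>\<^esub> y" "y \<sqsubseteq>\<^bsub>TLH \<phi>\<^esub> x" "x \<in> carrier (TLH \<phi>)" "y \<in> carrier (TLH \<phi>)"
    then obtain E F where EF: "E \<in> R_ce \<phi>" "F \<in> R_ce \<phi>"
      "x = equiv_Learn \<phi> `` {E}" "y = equiv_Learn \<phi> `` {F}"
      by (auto simp: carrier_TLH)
    with * have "le_Learn \<phi> E F" "le_Learn \<phi> F E" by (simp_all add: le_TLH_iff)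
    with EF have "(E, F) \<in> equiv_Learn \<phi>" by (simp add: equiv_Learn_def)
    with EF show "x = y" using equiv_class_eq[OF equiv_equiv_Learn] by metis
  qed (auto simp: carrier_TLH le_TLH_iff intro: le_Learn_refl le_Learn_trans)
qed

definition minimal_in :: "('a, 'b) gorder_scheme \<Rightarrow> 'a set \<Rightarrow> 'a \<Rightarrow> bool" where
  "minimal_in L S m \<longleftrightarrow> m \<in> S \<and> \<not> (\<exists>d\<in>S. d \<sqsubset>\<^bsub>L\<^esub> m)"

end

theory Submission
  imports Defs "HOL-Library.Countable_Set"
begin

text \<open>
  By a locking-sequence argument, a family is learnable up to \<open>E\<close> iff each member \<open>A\<close> has a finite
  tell-tale \<open>T \<subseteq> A\<close> such that all members between \<open>T\<close> and \<open>A\<close> are \<open>E\<close>-equivalent to \<open>A\<close>. Hence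
  \<open>E \<le> F\<close> in the learning order iff each c.e. set \<open>A\<close> has a finite \<open>T \<subseteq> A\<close> such that every c.e. set
  between \<open>T\<close> and \<open>A\<close> that is \<open>E\<close>-equivalent to \<open>A\<close> is also \<open>F\<close>-equivalent to \<open>A\<close>.

  Let \<open>E\<close> identify the co-singleton \<open>-{n}\<close> with all \<open>-{n, m}\<close>, \<open>m > n\<close>, and let \<open>F\<close> identify the
  whole of \<open>\<nat>\<close> with all co-singletons. If \<open>D\<close> bounds both, then for all but finitely many \<open>n\<close>
  there is \<open>m\<^sub>n > n\<close> with \<open>-{n, m\<^sub>n}\<close> equivalent to \<open>\<nat>\<close> under \<open>D\<close>. Splitting these sets off into
  classes of their own removes one set from each \<open>E\<close>-class, which the tell-tale of \<open>-{n}\<close> can absorb,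
  so the result still bounds \<open>E\<close> and \<open>F\<close>; but it lies strictly below \<open>D\<close>, since the sets
  \<open>-{n, m\<^sub>n}\<close> converge to \<open>\<nat>\<close>.
\<close>

section \<open>Cofinite sets are c.e.\<close>

text \<open>Induction on the bound: shifting \<open>S\<close> down by one gives a scheme for the
  values at successors, and \<open>Prec\<close> glues it to a constant at \<open>0\<close>. The
  recursion step reads the predecessor and discards the recursive value.\<close>

lemma recf_indicator:
  assumes "S \<subseteq> {..<N}"
  shows "\<exists>p. \<forall>x. recf_eval p [x] (if x \<in> S then 1 else 0)"
  using assms
proof (induction N arbitrary: S)
  case 0
  then show ?case by (auto intro: recf_eval.zero)
next
  case (Suc N)
  have "{n. Suc n \<in> S} \<subseteq> {..<N}" using Suc.prems by auto
  from Suc.IH[OF this] obtain q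
    where q: "\<And>x. recf_eval q [x] (if Suc x \<in> S then 1 else 0)" by auto
  have one: "recf_eval (Comp Succ [Zero]) [] 1"
    by (rule recf_eval.comp[where ys = "[0]"]) (auto intro: recf_eval.zero recf_eval.succ)
  obtain c where c: "recf_eval c [] (if 0 \<in> S then 1 else 0)"
    using one recf_eval.zero[of "[]"] by (metis (full_types))
  have "recf_eval (Prec c (Comp q [Proj 0])) [x] (if x \<in> S then 1 else 0)" for x
  proof (induction x)
    case 0
    show ?case using c by (rule recf_eval.prec_0)
  next
    case (Suc x)
    have "recf_eval (Comp q [Proj 0]) (x # y # []) (if Suc x \<in> S then 1 else 0)" for y
      by (rule recf_eval.comp[where ys = "[x]"])
        (use q[of x] recf_eval.proj[of 0 "[x, y]"] in auto)
    with Suc show ?case by (blast intro: recf_eval.prec_Suc)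
  qed
  then show ?case by blast
qed

text \<open>The domain is that of an unbounded search whose test ignores the search variable.\<close>

lemma cofinite_is_W:
  assumes "acceptable_enumeration \<phi>" and "finite (- A)"
  shows "\<exists>e. W \<phi> e = A"
proof -
  obtain N where "- A \<subseteq> {..<N}"
    using assms(2) finite_nat_iff_bounded by blast
  then obtain p where p: "\<And>x. recf_eval p [x] (if x \<in> - A then 1 else 0)"
    using recf_indicator by blast
  define f where "f = (\<lambda>x. if x \<in> A then Some (0::nat) else None)"
  define q where "q = Comp p [Proj 1]"
  have q: "recf_eval q [k, x] (if x \<in> - A then 1 else 0)" for k x
    unfolding q_def
    by (rule recf_eval.comp[where ys = "[x]"])
      (use p[of x] recf_eval.proj[of 1 "[k, x]"] in auto)
  have "f x = Some y \<longleftrightarrow> recf_eval (Mu q) [x] y" for x y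
  proof
    assume "f x = Some y"
    then have "x \<in> A" "y = 0" by (auto simp: f_def split: if_splits)
    then show "recf_eval (Mu q) [x] y"
      using q[of 0 x] by (auto intro: recf_eval.mu)
  next
    assume ev: "recf_eval (Mu q) [x] y"
    then have y: "recf_eval q [y, x] 0" "\<forall>m<y. \<exists>z>0. recf_eval q [m, x] z"
      by (cases, blast)+
    have "x \<in> A"
      using recf_eval_deterministic[OF y(1) q[of y x]] by (auto split: if_splits)
    \<comment> \<open>The test already vanishes at \<open>0\<close>, so the search cannot have
      passed it.\<close>
    moreover have "y = 0"
      using y(2) q[of 0 x] \<open>x \<in> A\<close> recf_eval_deterministic by (fastforce split: if_splits)
    ultimately show "f x = Some y" by (simp add: f_def)
  qed
  then have "partial_computable f" unfolding partial_computable_def by blast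
  then have "f \<in> range \<phi>"
    using assms(1) unfolding acceptable_enumeration_def by simp
  then obtain e where "\<phi> e = f" by auto
  then have "W \<phi> e = A" by (auto simp: W_def f_def dom_def split: if_splits)
  then show ?thesis ..
qed

section \<open>Tell-tales\<close>

lemma set_initial_segment: "set (initial_segment \<mu> s) = \<mu> ` {..<s}"
  by (auto simp: initial_segment_def)

text \<open>The strings form a chain, and \<open>\<sigma> (Suc i)\<close> is long enough to have an
  entry at position \<open>i\<close>; that entry is shared by every string reaching so far.\<close>

lemma initial_segment_limit:
  assumes "\<And>n. \<exists>\<tau>. \<sigma> (Suc n) = \<sigma> n @ \<tau>" and "\<And>n. n \<le> length (\<sigma> n)"
  obtains \<mu> where "\<And>n. initial_segment \<mu> (length (\<sigma> n)) = \<sigma> n"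
proof
  have ext: "\<exists>\<tau>. \<sigma> m = \<sigma> n @ \<tau>" if "n \<le> m" for n m
    using that by (induction m rule: dec_induct) (use assms(1) in \<open>auto, metis append.assoc\<close>)
  fix n
  show "initial_segment (\<lambda>i. \<sigma> (Suc i) ! i) (length (\<sigma> n)) = \<sigma> n"
  proof (rule nth_equalityI)
    fix i assume "i < length (initial_segment (\<lambda>i. \<sigma> (Suc i) ! i) (length (\<sigma> n)))"
    then have i: "i < length (\<sigma> n)" by (simp add: initial_segment_def)
    have "i < length (\<sigma> (Suc i))" using assms(2)[of "Suc i"] by simp
    with i have "\<sigma> (Suc i) ! i = \<sigma> n ! i"
      using ext[of n "Suc i"] ext[of "Suc i" n] by (metis nle_le nth_append)
    with i show "initial_segment (\<lambda>i. \<sigma> (Suc i) ! i) (length (\<sigma> n)) ! i = \<sigma> n ! i"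
      by (simp add: initial_segment_def)
  qed (simp add: initial_segment_def)
qed

text \<open>Otherwise every string over \<open>A\<close> has an extension over \<open>A\<close> on
  which \<open>M\<close> changes its value. Alternating such extensions with the elements of
  \<open>A\<close> yields an enumeration of \<open>A\<close> on which \<open>M\<close> never
  converges.\<close>

lemma locking_sequence:
  fixes M :: "nat list \<Rightarrow> nat"
  assumes "A \<noteq> {}"
    and conv: "\<And>\<mu>. enumeration_of \<mu> A \<Longrightarrow>
      \<exists>i. \<forall>\<^sub>F s in sequentially. M (initial_segment \<mu> s) = i"
  obtains \<sigma> where "\<sigma> \<in> lists A" "\<And>\<tau>. \<tau> \<in> lists A \<Longrightarrow> M (\<sigma> @ \<tau>) = M \<sigma>"
proof (rule ccontr)
  assume "\<not> thesis"
  with that have "\<forall>\<sigma>. \<sigma> \<in> lists A \<longrightarrow> (\<exists>\<tau>\<in>lists A. M (\<sigma> @ \<tau>) \<noteq> M \<sigma>)" by blast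
  then obtain t where t: "\<And>\<sigma>. \<sigma> \<in> lists A \<Longrightarrow> t \<sigma> \<in> lists A"
    and chg: "\<And>\<sigma>. \<sigma> \<in> lists A \<Longrightarrow> M (\<sigma> @ t \<sigma>) \<noteq> M \<sigma>" by metis
  define a where "a = from_nat_into A"
  have a: "range a = A"
    using assms(1) by (simp add: a_def range_from_nat_into)
  \<comment> \<open>Appending \<open>a n\<close> brings every element of \<open>A\<close> into the
    limit and makes the strings grow; \<open>t\<close> then forces a change of
    \<open>M\<close>.\<close>
  define \<sigma> where "\<sigma> = rec_nat [] (\<lambda>n \<rho>. (\<rho> @ [a n]) @ t (\<rho> @ [a n]))"
  have \<sigma>_Suc: "\<sigma> (Suc n) = (\<sigma> n @ [a n]) @ t (\<sigma> n @ [a n])" for n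
    by (simp add: \<sigma>_def)
  have lists: "\<sigma> n \<in> lists A" for n
  proof (induction n)
    case 0
    show ?case by (simp add: \<sigma>_def)
  next
    case (Suc n)
    then have "\<sigma> n @ [a n] \<in> lists A" using a by auto
    with t[OF this] show ?case by (simp add: \<sigma>_Suc)
  qed
  have lists': "\<sigma> n @ [a n] \<in> lists A" for n using lists a by auto
  have len: "n \<le> length (\<sigma> n)" for n
    by (induction n) (auto simp: \<sigma>_Suc)
  obtain \<mu> where \<mu>: "\<And>n. initial_segment \<mu> (length (\<sigma> n)) = \<sigma> n"
    using initial_segment_limit[of \<sigma>] \<sigma>_Suc len by (metis append.assoc)
  \<comment> \<open>The change happens between this prefix and \<open>\<sigma> (Suc n)\<close>, so
    both have to be initial segments of \<open>\<mu>\<close>.\<close>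
  have \<mu>': "initial_segment \<mu> (Suc (length (\<sigma> n))) = \<sigma> n @ [a n]" for n
  proof -
    have "take (Suc (length (\<sigma> n))) (initial_segment \<mu> (length (\<sigma> (Suc n))))
      = initial_segment \<mu> (Suc (length (\<sigma> n)))"
      by (simp add: initial_segment_def take_map \<sigma>_Suc take_upt del: upt_Suc)
    then show ?thesis unfolding \<mu> by (simp add: \<sigma>_Suc)
  qed
  have "range \<mu> = A"
  proof
    show "range \<mu> \<subseteq> A"
    proof clarify
      fix i
      have "\<mu> i \<in> set (initial_segment \<mu> (length (\<sigma> (Suc i))))"
        using len[of "Suc i"] by (auto simp: set_initial_segment)
      then show "\<mu> i \<in> A" unfolding \<mu> using lists by auto
    qed
    show "A \<subseteq> range \<mu>"
    proof
      fix x assume "x \<in> A"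
      then obtain n where "x = a n" using a by auto
      then have "x \<in> set (initial_segment \<mu> (Suc (length (\<sigma> n))))" by (simp add: \<mu>')
      then show "x \<in> range \<mu>" by (auto simp: set_initial_segment)
    qed
  qed
  then obtain i s where s: "\<And>s'. s \<le> s' \<Longrightarrow> M (initial_segment \<mu> s') = i"
    using conv unfolding enumeration_of_def eventually_sequentially by metis
  have "M (\<sigma> s @ [a s]) = i" "M (\<sigma> (Suc s)) = i"
    using s[of "Suc (length (\<sigma> s))"] s[of "length (\<sigma> (Suc s))"] len[of s] len[of "Suc s"]
    by (simp_all add: \<mu> \<mu>')
  with chg[OF lists', of s] show False unfolding \<sigma>_Suc by simp
qed

text \<open>The content of a locking sequence for \<open>W \<phi> e\<close> is a tell-tale: a member
  between it and \<open>W \<phi> e\<close> has an enumeration starting with that sequence, on which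
  the learner never leaves \<open>M \<sigma>\<close>.\<close>

lemma learnable_imp_tell_tale:
  assumes E: "equiv UNIV E" and K: "K \<subseteq> nonempty_ce_sets \<phi>"
    and "learnable \<phi> E K" and e: "W \<phi> e \<in> K"
  obtains T where "finite T" "T \<subseteq> W \<phi> e"
    "\<And>e'. \<lbrakk>W \<phi> e' \<in> K; T \<subseteq> W \<phi> e'; W \<phi> e' \<subseteq> W \<phi> e\<rbrakk> \<Longrightarrow> (e', e) \<in> E"
proof -
  obtain M where M: "\<And>e \<mu>. \<lbrakk>W \<phi> e \<in> K; enumeration_of \<mu> (W \<phi> e)\<rbrakk> \<Longrightarrow>
      \<exists>i. (i, e) \<in> E \<and> (\<forall>\<^sub>F s in sequentially. M (initial_segment \<mu> s) = i)"
    using assms(3) unfolding learnable_def by blast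
  have ne: "W \<phi> e' \<noteq> {}" if "W \<phi> e' \<in> K" for e'
    using K that by (auto simp: nonempty_ce_sets_def)
  obtain \<sigma> where \<sigma>: "\<sigma> \<in> lists (W \<phi> e)"
    and lock: "\<And>\<tau>. \<tau> \<in> lists (W \<phi> e) \<Longrightarrow> M (\<sigma> @ \<tau>) = M \<sigma>"
    using locking_sequence[of "W \<phi> e" M] ne[OF e] M[OF e] by metis
  have locked: "(M \<sigma>, e') \<in> E"
    if e': "W \<phi> e' \<in> K" "set \<sigma> \<subseteq> W \<phi> e'" "W \<phi> e' \<subseteq> W \<phi> e" for e'
  proof -
    define a where "a = from_nat_into (W \<phi> e')"
    have a: "range a = W \<phi> e'"
      using ne[OF e'(1)] by (simp add: a_def range_from_nat_into)
    define \<mu> where "\<mu> i = (if i < length \<sigma> then \<sigma> ! i else a (i - length \<sigma>))" for i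
    have seg: "initial_segment \<mu> (length \<sigma> + k) = \<sigma> @ map a [0..<k]" for k
      by (rule nth_equalityI) (auto simp: initial_segment_def \<mu>_def nth_append)
    have "range \<mu> = W \<phi> e'"
    proof
      show "range \<mu> \<subseteq> W \<phi> e'" using e'(2) a by (auto simp: \<mu>_def)
      have "a i \<in> range \<mu>" for i
        by (rule range_eqI[of _ _ "length \<sigma> + i"]) (simp add: \<mu>_def)
      then show "W \<phi> e' \<subseteq> range \<mu>" unfolding a[symmetric] by blast
    qed
    then obtain i s where i: "(i, e') \<in> E"
      and s: "\<And>s'. s \<le> s' \<Longrightarrow> M (initial_segment \<mu> s') = i"
      using M[OF e'(1)] unfolding enumeration_of_def eventually_sequentially by metis
    have "set (map a [0..<s]) \<subseteq> range a" by auto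
    then have "map a [0..<s] \<in> lists (W \<phi> e)" using e'(3) unfolding a by (auto simp: in_lists_conv_set)
    then have "M \<sigma> = i" using lock s[of "length \<sigma> + s"] by (simp add: seg)
    with i show ?thesis by simp
  qed
  show thesis
  proof (rule that[of "set \<sigma>"])
    fix e' assume "W \<phi> e' \<in> K" "set \<sigma> \<subseteq> W \<phi> e'" "W \<phi> e' \<subseteq> W \<phi> e"
    then have "(M \<sigma>, e') \<in> E" by (rule locked)
    moreover have "(M \<sigma>, e) \<in> E" using locked e \<sigma> by auto
    ultimately show "(e', e) \<in> E" using E by (meson equivE symD transD)
  qed (use \<sigma> in auto)
qed

text \<open>
  The learner conjectures the least index in the family that is consistent with the data and whose
  tell-tale has been seen.
\<close>

lemma tell_tale_imp_learnable:
  assumes "sym E"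
    and tt: "\<And>e. W \<phi> e \<in> K \<Longrightarrow> \<exists>T. finite T \<and> T \<subseteq> W \<phi> e \<and>
      (\<forall>e'. W \<phi> e' \<in> K \<and> T \<subseteq> W \<phi> e' \<and> W \<phi> e' \<subseteq> W \<phi> e \<longrightarrow> (e', e) \<in> E)"
  shows "learnable \<phi> E K"
proof -
  obtain T where fin: "\<And>e. W \<phi> e \<in> K \<Longrightarrow> finite (T e)"
    and sub: "\<And>e. W \<phi> e \<in> K \<Longrightarrow> T e \<subseteq> W \<phi> e"
    and T: "\<And>e e'. \<lbrakk>W \<phi> e \<in> K; W \<phi> e' \<in> K; T e \<subseteq> W \<phi> e'; W \<phi> e' \<subseteq> W \<phi> e\<rbrakk> \<Longrightarrow> (e', e) \<in> E"
    using tt by metis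
  define P where "P X n \<longleftrightarrow> W \<phi> n \<in> K \<and> T n \<subseteq> X \<and> X \<subseteq> W \<phi> n" for X n
  define M where "M \<sigma> = (LEAST n. P (set \<sigma>) n)" for \<sigma>
  have "\<exists>i. (i, e) \<in> E \<and> (\<forall>\<^sub>F s in sequentially. M (initial_segment \<mu> s) = i)"
    if e: "W \<phi> e \<in> K" and "enumeration_of \<mu> (W \<phi> e)" for e \<mu>
  proof -
    have \<mu>: "range \<mu> = W \<phi> e" using that by (simp add: enumeration_of_def)
    define i where "i = (LEAST n. P (W \<phi> e) n)"
    have "P (W \<phi> e) e" using e sub by (simp add: P_def)
    then have i: "P (W \<phi> e) i" unfolding i_def by (rule LeastI)
    have mem: "\<forall>\<^sub>F s in sequentially. x \<in> \<mu> ` {..<s}" if x: "x \<in> W \<phi> e" for x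
    proof -
      obtain j where "x = \<mu> j" using x \<mu> by blast
      then show ?thesis
        unfolding eventually_sequentially by (intro exI[of _ "Suc j"]) auto
    qed
    \<comment> \<open>Each single index is judged correctly in the limit: inconsistency eventually
      shows, and a finite tell-tale is eventually seen if it lies in \<open>W \<phi> e\<close> and
      never otherwise.\<close>
    have ev: "\<forall>\<^sub>F s in sequentially. P (\<mu> ` {..<s}) n \<longleftrightarrow> P (W \<phi> e) n" for n
    proof (cases "W \<phi> n \<in> K \<and> W \<phi> e \<subseteq> W \<phi> n")
      case True
      show ?thesis
      proof (cases "T n \<subseteq> W \<phi> e")
        case T: True
        then have "\<forall>\<^sub>F s in sequentially. \<forall>x\<in>T n. x \<in> \<mu> ` {..<s}"
          using True fin mem by (intro eventually_ball_finite) auto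
        then show ?thesis
          by eventually_elim (use True T \<mu> in \<open>auto simp: P_def\<close>)
      next
        case False
        moreover have "\<mu> ` {..<s} \<subseteq> W \<phi> e" for s unfolding \<mu>[symmetric] by auto
        ultimately have "\<not> T n \<subseteq> \<mu> ` {..<s}" for s by blast
        with False show ?thesis by (simp add: P_def)
      qed
    next
      case False
      show ?thesis
      proof (cases "W \<phi> n \<in> K")
        case True
        with False obtain x where x: "x \<in> W \<phi> e" "x \<notin> W \<phi> n" by auto
        from mem[OF x(1)] show ?thesis
          by eventually_elim (use x in \<open>auto simp: P_def\<close>)
      qed (simp add: P_def)
    qed
    \<comment> \<open>Whether \<open>i\<close> is least depends only on the indices up to
      \<open>i\<close>, so finitely many limits suffice.\<close>
    have "\<forall>\<^sub>F s in sequentially. \<forall>n\<in>{..i}. P (\<mu> ` {..<s}) n \<longleftrightarrow> P (W \<phi> e) n"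
      using ev by (intro eventually_ball_finite) auto
    then have "\<forall>\<^sub>F s in sequentially. M (initial_segment \<mu> s) = i"
    proof eventually_elim
      case (elim s)
      show ?case unfolding M_def set_initial_segment
      proof (rule Least_equality)
        show "P (\<mu> ` {..<s}) i" using elim i by simp
        fix n assume "P (\<mu> ` {..<s}) n"
        with elim show "i \<le> n"
          unfolding i_def by (metis Least_le atMost_iff nle_le)
      qed
    qed
    \<comment> \<open>Since \<open>T i\<close> is contained in \<open>W \<phi> e\<close> and
      \<open>W \<phi> e\<close> in \<open>W \<phi> i\<close>, the tell-tale of \<open>i\<close>, not
      that of \<open>e\<close>, relates the two.\<close>
    moreover have "(i, e) \<in> E"
      using T[of i e] i e assms(1) by (auto simp: P_def dest: symD)
    ultimately show ?thesis by blast
  qed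
  then show ?thesis unfolding learnable_def by blast
qed

section \<open>Learning reducibility in terms of tell-tales\<close>

text \<open>If the condition fails at \<open>e\<close>, some subsets of \<open>W \<phi> e\<close>
  converge to it while being \<open>E\<close>-equivalent but not \<open>F\<close>-equivalent to it;
  together with \<open>W \<phi> e\<close> they form a family learnable for \<open>E\<close> but not
  for \<open>F\<close>. Conversely, a tell-tale for \<open>E\<close> joined with the
  \<open>T\<close> of the condition is a tell-tale for \<open>F\<close>.\<close>

lemma le_Learn_iff:
  assumes "E \<in> R_ce \<phi>" "F \<in> R_ce \<phi>"
  shows "le_Learn \<phi> E F \<longleftrightarrow>
    (\<forall>e. \<exists>T. finite T \<and> T \<subseteq> W \<phi> e \<and>
      (\<forall>e'. T \<subseteq> W \<phi> e' \<and> W \<phi> e' \<subseteq> W \<phi> e \<and> (e', e) \<in> E \<longrightarrow> (e', e) \<in> F))"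
    (is "_ \<longleftrightarrow> (\<forall>e. ?local e)")
proof
  have eqE: "(a, b) \<in> E" if "W \<phi> a = W \<phi> b" for a b
    using assms(1) that by (auto simp: R_ce_def eq_ce_def)
  have eqF: "(a, b) \<in> F" if "W \<phi> a = W \<phi> b" for a b
    using assms(2) that by (auto simp: R_ce_def eq_ce_def)
  assume le: "le_Learn \<phi> E F"
  show "\<forall>e. ?local e"
  proof (rule ccontr)
    assume "\<not> (\<forall>e. ?local e)"
    then obtain e where e: "\<not> ?local e" by blast
    have "W \<phi> e \<noteq> {}"
    proof
      assume "W \<phi> e = {}"
      then have "?local e" using eqF by (intro exI[of _ "{}"]) auto
      with e show False by contradiction
    qed
    then obtain x0 where x0: "x0 \<in> W \<phi> e" by blast
    \<comment> \<open>Including \<open>x0\<close> keeps the approximating sets nonempty, as members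
      of a family have to be.\<close>
    have "\<exists>e'. insert x0 (W \<phi> e \<inter> {..<n}) \<subseteq> W \<phi> e' \<and> W \<phi> e' \<subseteq> W \<phi> e \<and> (e', e) \<in> E \<and> (e', e) \<notin> F"
      for n :: nat
      using e x0 by (metis Int_lower1 finite_Int finite_insert finite_lessThan insert_subset)
    then obtain b where b: "\<And>n. insert x0 (W \<phi> e \<inter> {..<n}) \<subseteq> W \<phi> (b n)"
      "\<And>n. W \<phi> (b n) \<subseteq> W \<phi> e" "\<And>n. (b n, e) \<in> E" "\<And>n. (b n, e) \<notin> F"
      by metis
    define K where "K = insert (W \<phi> e) (range (\<lambda>n. W \<phi> (b n)))"
    have K: "K \<subseteq> nonempty_ce_sets \<phi>"
      using x0 b(1) by (auto simp: K_def nonempty_ce_sets_def)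
    have eqvE: "equiv UNIV E" and eqvF: "equiv UNIV F"
      using assms by (auto simp: R_ce_def)
    have "learnable \<phi> E K"
    proof (rule tell_tale_imp_learnable)
      show "sym E" using eqvE by (rule equivE)
      fix a assume a: "W \<phi> a \<in> K"
      show "\<exists>T. finite T \<and> T \<subseteq> W \<phi> a \<and>
        (\<forall>e'. W \<phi> e' \<in> K \<and> T \<subseteq> W \<phi> e' \<and> W \<phi> e' \<subseteq> W \<phi> a \<longrightarrow> (e', a) \<in> E)"
      proof (cases "W \<phi> a = W \<phi> e")
        case True
        have "(e', a) \<in> E" if "W \<phi> e' \<in> K" for e'
        proof -
          from that consider "W \<phi> e' = W \<phi> e" | n where "W \<phi> e' = W \<phi> (b n)"
            unfolding K_def by blast
          then have "(e', e) \<in> E"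
          proof cases
            case 1 then show ?thesis by (rule eqE)
          next
            case (2 n)
            then show ?thesis using eqE b(3) eqvE by (meson equivE transD)
          qed
          moreover have "(e, a) \<in> E" using True by (intro eqE) simp
          ultimately show ?thesis using eqvE by (meson equivE transD)
        qed
        then show ?thesis by (intro exI[of _ "{}"]) simp
      next
        case False
        then obtain k where k: "W \<phi> a = W \<phi> (b k)" using a by (auto simp: K_def)
        obtain x where x: "x \<in> W \<phi> e" "x \<notin> W \<phi> a" using False b(2)[of k] k by auto
        \<comment> \<open>Only finitely many sets of the sequence can lie inside
          \<open>W \<phi> a\<close>, because later ones contain \<open>x\<close>.\<close>
        have large: "n \<le> x" if "W \<phi> (b n) \<subseteq> W \<phi> a" for n
        proof (rule ccontr)
          assume "\<not> n \<le> x"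
          then have "x \<in> W \<phi> (b n)" using b(1)[of n] x(1) by auto
          with that x(2) show False by blast
        qed
        \<comment> \<open>One point of \<open>W \<phi> a\<close> is chosen against each early set
          that fails to contain \<open>W \<phi> a\<close>. A member of \<open>K\<close> between
          \<open>T\<close> and \<open>W \<phi> a\<close> must then equal
          \<open>W \<phi> a\<close>.\<close>
        define T where "T = (\<lambda>n. SOME y. y \<in> W \<phi> a - W \<phi> (b n)) ` {n. n \<le> x \<and> \<not> W \<phi> a \<subseteq> W \<phi> (b n)}"
        have wit: "(SOME y. y \<in> W \<phi> a - W \<phi> (b n)) \<in> W \<phi> a - W \<phi> (b n)"
          if "\<not> W \<phi> a \<subseteq> W \<phi> (b n)" for n
          by (rule someI_ex) (use that in blast)
        have "finite T" unfolding T_def by simp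
        moreover have "T \<subseteq> W \<phi> a" unfolding T_def using wit by auto
        moreover have "(e', a) \<in> E"
          if e': "W \<phi> e' \<in> K" "T \<subseteq> W \<phi> e'" "W \<phi> e' \<subseteq> W \<phi> a" for e'
        proof -
          obtain n where n: "W \<phi> e' = W \<phi> (b n)"
            using e' False b(2)[of k] k by (auto simp: K_def)
          have "W \<phi> a \<subseteq> W \<phi> (b n)"
          proof (rule ccontr)
            assume "\<not> W \<phi> a \<subseteq> W \<phi> (b n)"
            then have "(SOME y. y \<in> W \<phi> a - W \<phi> (b n)) \<in> T - W \<phi> (b n)"
              using wit large e'(3) n by (auto simp: T_def)
            with e'(2) n show False by auto
          qed
          with e'(3) n show ?thesis by (intro eqE) auto
        qed
        ultimately show ?thesis by blast
      qed
    qed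
    then have "learnable \<phi> F K" using le K by (simp add: le_Learn_def)
    moreover have "W \<phi> e \<in> K" by (simp add: K_def)
    ultimately obtain T where T: "finite T" "T \<subseteq> W \<phi> e"
      "\<And>e'. \<lbrakk>W \<phi> e' \<in> K; T \<subseteq> W \<phi> e'; W \<phi> e' \<subseteq> W \<phi> e\<rbrakk> \<Longrightarrow> (e', e) \<in> F"
      using learnable_imp_tell_tale[OF eqvF K] by metis
    obtain n where "T \<subseteq> {..<n}" using T(1) finite_nat_iff_bounded by blast
    then have "T \<subseteq> W \<phi> (b n)" using T(2) b(1)[of n] by auto
    then have "(b n, e) \<in> F" using T(3) b(2) by (auto simp: K_def)
    with b(4) show False by blast
  qed
next
  assume loc: "\<forall>e. ?local e"
  have eqvE: "equiv UNIV E" and eqvF: "equiv UNIV F"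
    using assms by (auto simp: R_ce_def)
  show "le_Learn \<phi> E F" unfolding le_Learn_def
  proof (intro allI impI)
    fix K assume K: "K \<subseteq> nonempty_ce_sets \<phi>" "learnable \<phi> E K"
    show "learnable \<phi> F K"
    proof (rule tell_tale_imp_learnable)
      show "sym F" using eqvF by (rule equivE)
      fix e assume e: "W \<phi> e \<in> K"
      obtain T where T: "finite T" "T \<subseteq> W \<phi> e"
        "\<And>e'. \<lbrakk>W \<phi> e' \<in> K; T \<subseteq> W \<phi> e'; W \<phi> e' \<subseteq> W \<phi> e\<rbrakk> \<Longrightarrow> (e', e) \<in> E"
        using learnable_imp_tell_tale[OF eqvE K e] by blast
      obtain T' where T': "finite T'" "T' \<subseteq> W \<phi> e"
        "\<And>e'. T' \<subseteq> W \<phi> e' \<and> W \<phi> e' \<subseteq> W \<phi> e \<and> (e', e) \<in> E \<Longrightarrow> (e', e) \<in> F"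
        using loc by metis
      show "\<exists>T. finite T \<and> T \<subseteq> W \<phi> e \<and>
        (\<forall>e'. W \<phi> e' \<in> K \<and> T \<subseteq> W \<phi> e' \<and> W \<phi> e' \<subseteq> W \<phi> e \<longrightarrow> (e', e) \<in> F)"
        using T T' by (intro exI[of _ "T \<union> T'"]) auto
    qed
  qed
qed

section \<open>The two relations\<close>

text \<open>A normal form whose kernel is the relation \<open>E\<close>: \<open>- {n}\<close>
  represents itself and all \<open>- {n, m}\<close> with \<open>m > n\<close>. As
  \<open>card\<close> is 0 on infinite sets, sets with infinite complement are fixed, here and in
  \<open>co_fill\<close>.\<close>

definition co_min :: "nat set \<Rightarrow> nat set" where
  "co_min X = (if card (- X) \<in> {1, 2} then - {LEAST n. n \<notin> X} else X)"

definition co_fill :: "nat set \<Rightarrow> nat set" where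
  "co_fill X = (if card (- X) = 1 then UNIV else X)"

text \<open>A relation given by a normal form on sets is automatically an equivalence extending
  equality of c.e. sets.\<close>

definition kernel_ce :: "(nat \<Rightarrow> nat \<Rightarrow> nat option) \<Rightarrow> (nat set \<Rightarrow> nat set) \<Rightarrow> nat rel" where
  "kernel_ce \<phi> h = {(e, e'). h (W \<phi> e) = h (W \<phi> e')}"

lemma kernel_ce_in_R_ce: "kernel_ce \<phi> h \<in> R_ce \<phi>"
  unfolding R_ce_def kernel_ce_def eq_ce_def
  by (auto intro!: equivI refl_onI symI transI)

text \<open>Allowing \<open>n = m\<close> treats complements of one and of two points at
  once.\<close>

lemma co_min_pair: "n \<le> m \<Longrightarrow> co_min (- {n, m}) = - {n}"
proof -
  assume "n \<le> m"
  then have "(LEAST k. k \<notin> - {n, m}) = n"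
    by (intro Least_equality) auto
  moreover have "card {n, m} \<in> {1, 2}" by (cases "n = m") auto
  ultimately show ?thesis by (simp add: co_min_def)
qed

lemma co_min_cases:
  obtains "co_min X = X" "card (- X) \<notin> {1, 2}" | n m where "n \<le> m" "X = - {n, m}"
proof (cases "card (- X) \<in> {1, 2}")
  case False
  then show ?thesis using that(1) by (auto simp: co_min_def)
next
  case True
  then have "\<exists>a b. - X = {a, b}" by (auto simp: card_1_singleton_iff card_2_iff)
  then obtain a b where "X = - {a, b}" by (metis double_complement)
  then show ?thesis
    using that(2)[of a b] that(2)[of b a] by (metis insert_commute nle_le)
qed

text \<open>Determines the pairs that tell-tales for \<open>E\<close> have to handle. Both sets must
  miss one or two points with the same least one; strictness then forces the larger set to miss only
  that point.\<close>

lemma co_min_proper_subset: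
  assumes "co_min Y = co_min X" "Y \<subset> X"
  obtains n m where "n < m" "X = - {n}" "Y = - {n, m}"
proof (cases X rule: co_min_cases)
  case 1
  show ?thesis
  proof (cases Y rule: co_min_cases)
    case 1
    with assms \<open>co_min X = X\<close> show ?thesis by simp
  next
    case (2 n m)
    then have "X = - {n}" using assms(1) 1 co_min_pair by simp
    with 1 show ?thesis by simp
  qed
next
  case (2 n m)
  then have X: "co_min X = - {n}" using co_min_pair by simp
  show ?thesis
  proof (cases Y rule: co_min_cases)
    case 1
    then have "Y = - {n}" using assms(1) X by simp
    with 1 show ?thesis by simp
  next
    case Y: (2 n' m')
    then have "n' = n" using X assms(1) co_min_pair by simp
    have sub: "- {n, m'} \<subset> - {n, m}"
      using assms(2) unfolding 2(2) Y(2) \<open>n' = n\<close> .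
    then have "m \<noteq> m'" "m \<in> {n, m'}" by blast+
    then have "m = n" "n < m'" using Y(1) \<open>n' = n\<close> by auto
    with 2 Y \<open>n' = n\<close> show ?thesis using that by simp
  qed
qed

section \<open>Splitting sets off into classes of their own\<close>

text \<open>Keeping \<open>eq_ce\<close> holds together the indices of each isolated set.\<close>

definition isolate :: "(nat \<Rightarrow> nat \<Rightarrow> nat option) \<Rightarrow> nat set set \<Rightarrow> nat rel \<Rightarrow> nat rel" where
  "isolate \<phi> S D = eq_ce \<phi> \<union> {(e, e') \<in> D. W \<phi> e \<notin> S \<and> W \<phi> e' \<notin> S}"

lemma isolate_in_R_ce: "D \<in> R_ce \<phi> \<Longrightarrow> isolate \<phi> S D \<in> R_ce \<phi>"
proof -
  assume "D \<in> R_ce \<phi>"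
  then have D: "equiv UNIV D" "eq_ce \<phi> \<subseteq> D" by (auto simp: R_ce_def)
  have "refl (isolate \<phi> S D)"
    by (auto simp: isolate_def eq_ce_def intro: refl_onI)
  moreover have "sym (isolate \<phi> S D)"
    using D(1) by (auto simp: isolate_def eq_ce_def equiv_def intro!: symI dest: symD)
  moreover have "trans (isolate \<phi> S D)"
  proof (rule transI)
    fix x y z assume xyz: "(x, y) \<in> isolate \<phi> S D" "(y, z) \<in> isolate \<phi> S D"
    then have "(x, y) \<in> D" "(y, z) \<in> D" using D(2) by (auto simp: isolate_def)
    then have "(x, z) \<in> D" using D(1) by (meson equivE transD)
    \<comment> \<open>If one of the pairs comes from \<open>eq_ce\<close>, its indices name the same
      set, so membership in \<open>S\<close> carries over.\<close>
    then show "(x, z) \<in> isolate \<phi> S D" using xyz by (auto simp: isolate_def eq_ce_def)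
  qed
  ultimately show ?thesis
    by (auto simp: R_ce_def isolate_def intro: equivI)
qed

lemma isolate_subset: "D \<in> R_ce \<phi> \<Longrightarrow> isolate \<phi> S D \<subseteq> D"
  by (auto simp: isolate_def R_ce_def)

text \<open>Isolation only breaks pairs of distinct sets at least one of which lies in
  \<open>S\<close>. The finite set from \<open>avoid\<close> excludes these, so its union with a
  finite set witnessing reducibility to \<open>D\<close> works.\<close>

lemma le_Learn_isolate:
  assumes "E \<in> R_ce \<phi>" "D \<in> R_ce \<phi>" "le_Learn \<phi> E D"
    and avoid: "\<And>e. \<exists>T. finite T \<and> T \<subseteq> W \<phi> e \<and>
      (\<forall>e'. T \<subseteq> W \<phi> e' \<and> W \<phi> e' \<subset> W \<phi> e \<and> (e', e) \<in> E \<longrightarrow> W \<phi> e' \<notin> S \<and> W \<phi> e \<notin> S)"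
  shows "le_Learn \<phi> E (isolate \<phi> S D)"
  unfolding le_Learn_iff[OF assms(1) isolate_in_R_ce[OF assms(2)]]
proof
  fix e
  obtain T where T: "finite T" "T \<subseteq> W \<phi> e"
    "\<And>e'. T \<subseteq> W \<phi> e' \<and> W \<phi> e' \<subseteq> W \<phi> e \<and> (e', e) \<in> E \<Longrightarrow> (e', e) \<in> D"
    using assms(3) unfolding le_Learn_iff[OF assms(1,2)] by metis
  obtain T' where T': "finite T'" "T' \<subseteq> W \<phi> e"
    "\<And>e'. T' \<subseteq> W \<phi> e' \<and> W \<phi> e' \<subset> W \<phi> e \<and> (e', e) \<in> E \<Longrightarrow> W \<phi> e' \<notin> S \<and> W \<phi> e \<notin> S"
    using avoid by metis
  show "\<exists>T. finite T \<and> T \<subseteq> W \<phi> e \<and>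
    (\<forall>e'. T \<subseteq> W \<phi> e' \<and> W \<phi> e' \<subseteq> W \<phi> e \<and> (e', e) \<in> E \<longrightarrow> (e', e) \<in> isolate \<phi> S D)"
  proof (intro exI[of _ "T \<union> T'"] conjI allI impI)
    fix e' assume e': "T \<union> T' \<subseteq> W \<phi> e' \<and> W \<phi> e' \<subseteq> W \<phi> e \<and> (e', e) \<in> E"
    then have "(e', e) \<in> D" using T(3) by simp
    moreover have "W \<phi> e' \<notin> S \<and> W \<phi> e \<notin> S" if "W \<phi> e' \<noteq> W \<phi> e"
      using T'(3) e' that by blast
    ultimately show "(e', e) \<in> isolate \<phi> S D" by (auto simp: isolate_def eq_ce_def)
  qed (use T T' in auto)
qed

section \<open>Every common upper bound can be lowered\<close>

lemma smaller_upper_bound: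
  assumes acc: "acceptable_enumeration \<phi>" and D: "D \<in> R_ce \<phi>"
    and ED: "le_Learn \<phi> (kernel_ce \<phi> co_min) D"
    and FD: "le_Learn \<phi> (kernel_ce \<phi> co_fill) D"
  obtains D' where "D' \<in> R_ce \<phi>" "le_Learn \<phi> (kernel_ce \<phi> co_min) D'"
    "le_Learn \<phi> (kernel_ce \<phi> co_fill) D'" "le_Learn \<phi> D' D" "\<not> le_Learn \<phi> D D'"
proof -
  note E_iff = le_Learn_iff[OF kernel_ce_in_R_ce D, of co_min]
  note F_iff = le_Learn_iff[OF kernel_ce_in_R_ce D, of co_fill]
  have "\<exists>i. \<forall>X. finite (- X) \<longrightarrow> W \<phi> (i X) = X"
    using cofinite_is_W[OF acc] by metis
  then obtain i where i: "\<And>X. finite (- X) \<Longrightarrow> W \<phi> (i X) = X" by blast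
  obtain T where T: "finite T" "\<And>e'. \<lbrakk>T \<subseteq> W \<phi> e'; (e', i UNIV) \<in> kernel_ce \<phi> co_fill\<rbrakk>
      \<Longrightarrow> (e', i UNIV) \<in> D"
    using FD[unfolded F_iff, rule_format, of "i UNIV"] i[of UNIV] by auto
  \<comment> \<open>For \<open>n\<close> outside \<open>T\<close>, the set \<open>- {n}\<close>
    still contains the tell-tale \<open>T\<close> of \<open>UNIV\<close>.\<close>
  have single: "(i (- {n}), i UNIV) \<in> D" if "n \<notin> T" for n
    using that T(2)[of "i (- {n})"] i[of UNIV] i[of "- {n}"]
    by (auto simp: kernel_ce_def co_fill_def)
  have "\<exists>m>n. (i (- {n, m}), i (- {n})) \<in> D" for n
  proof -
    obtain U where U: "finite U" "\<And>e'. \<lbrakk>U \<subseteq> W \<phi> e'; W \<phi> e' \<subseteq> - {n};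
        (e', i (- {n})) \<in> kernel_ce \<phi> co_min\<rbrakk> \<Longrightarrow> (e', i (- {n})) \<in> D" "U \<subseteq> - {n}"
      using ED[unfolded E_iff, rule_format, of "i (- {n})"] i[of "- {n}"] by auto
    \<comment> \<open>Any \<open>m > n\<close> outside \<open>U\<close> will do, since
      \<open>- {n, m}\<close> then still contains \<open>U\<close>.\<close>
    obtain m where "m \<notin> U \<union> {..n}"
      using ex_new_if_finite[of "U \<union> {..n}"] U(1) by auto
    then have m: "m > n" "m \<notin> U" by auto
    have "co_min (- {n, m}) = co_min (- {n})"
      using m co_min_pair[of n m] co_min_pair[of n n] by simp
    with m U(3) have "(i (- {n, m}), i (- {n})) \<in> D"
      by (intro U(2)) (auto simp: kernel_ce_def i)
    with m show ?thesis by blast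
  qed
  then obtain m where m: "\<And>n. n < m n" "\<And>n. (i (- {n, m n}), i (- {n})) \<in> D" by metis
  define S where "S = range (\<lambda>n. - {n, m n})"
  have card_S: "card (- X) = 2" if "X \<in> S" for X
  proof -
    obtain n where "X = - {n, m n}" using \<open>X \<in> S\<close> unfolding S_def by blast
    then show ?thesis using m(1)[of n] by simp
  qed
  define D' where "D' = isolate \<phi> S D"
  have D': "D' \<in> R_ce \<phi>" using D isolate_in_R_ce by (simp add: D'_def)
  have ED': "le_Learn \<phi> (kernel_ce \<phi> co_min) D'"
    unfolding D'_def
  proof (rule le_Learn_isolate[OF kernel_ce_in_R_ce D ED])
    fix e
    \<comment> \<open>Requiring the point \<open>m n\<close> excludes the isolated subset of
      \<open>- {n}\<close>. For sets not of this form \<open>V\<close> is empty, as they have no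
      \<open>E\<close>-equivalent proper subsets.\<close>
    define V where "V = {m n | n. W \<phi> e = - {n}}"
    have "finite V \<and> V \<subseteq> W \<phi> e"
    proof (cases "\<exists>n. W \<phi> e = - {n}")
      case True
      then obtain n where n: "W \<phi> e = - {n}" by blast
      have "V = {m n}" unfolding V_def n by simp
      then show ?thesis using m(1)[of n] n by simp
    next
      case False
      then have "V = {}" unfolding V_def by blast
      then show ?thesis by simp
    qed
    moreover have "W \<phi> e' \<notin> S \<and> W \<phi> e \<notin> S"
      if e': "V \<subseteq> W \<phi> e'" "W \<phi> e' \<subset> W \<phi> e" "(e', e) \<in> kernel_ce \<phi> co_min" for e'
    proof -
      have "co_min (W \<phi> e') = co_min (W \<phi> e)" using e'(3) by (simp add: kernel_ce_def)
      then obtain n k where nk: "n < k" "W \<phi> e = - {n}" "W \<phi> e' = - {n, k}"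
        using e'(2) by (rule co_min_proper_subset)
      then have "m n \<in> V" unfolding V_def by blast
      then have "k \<noteq> m n" using e'(1) nk by auto
      have "W \<phi> e' \<notin> S"
      proof
        assume "W \<phi> e' \<in> S"
        then obtain n' where "- {n, k} = - {n', m n'}" unfolding nk(3) S_def by blast
        then have "{n, k} = {n', m n'}" by (simp only: Compl_eq_Compl_iff)
        \<comment> \<open>Both pairs are listed in increasing order, so equality would give
          \<open>n' = n\<close> and \<open>k = m n\<close>.\<close>
        then show False
          using nk(1) m(1)[of n'] \<open>k \<noteq> m n\<close> by (auto simp: doubleton_eq_iff)
      qed
      moreover have "W \<phi> e \<notin> S" using card_S[of "W \<phi> e"] nk(2) by auto
      ultimately show ?thesis ..
    qed
    ultimately show "\<exists>T. finite T \<and> T \<subseteq> W \<phi> e \<and> (\<forall>e'. T \<subseteq> W \<phi> e' \<and> W \<phi> e' \<subset> W \<phi> e \<and>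
        (e', e) \<in> kernel_ce \<phi> co_min \<longrightarrow> W \<phi> e' \<notin> S \<and> W \<phi> e \<notin> S)"
      by blast
  qed
  have FD': "le_Learn \<phi> (kernel_ce \<phi> co_fill) D'"
    unfolding D'_def
  proof (rule le_Learn_isolate[OF kernel_ce_in_R_ce D FD])
    fix e
    \<comment> \<open>Distinct sets identified by \<open>co_fill\<close> miss at most one point
      each, while members of \<open>S\<close> miss two; hence the empty tell-tale works.\<close>
    have "W \<phi> e' \<notin> S \<and> W \<phi> e \<notin> S"
      if "W \<phi> e' \<noteq> W \<phi> e" "(e', e) \<in> kernel_ce \<phi> co_fill" for e'
      using that card_S[of "W \<phi> e"] card_S[of "W \<phi> e'"]
      by (auto simp: kernel_ce_def co_fill_def split: if_splits)
    then show "\<exists>T. finite T \<and> T \<subseteq> W \<phi> e \<and> (\<forall>e'. T \<subseteq> W \<phi> e' \<and> W \<phi> e' \<subset> W \<phi> e \<and>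
        (e', e) \<in> kernel_ce \<phi> co_fill \<longrightarrow> W \<phi> e' \<notin> S \<and> W \<phi> e \<notin> S)"
      by (intro exI[of _ "{}"]) auto
  qed
  have "D' \<subseteq> D" unfolding D'_def by (rule isolate_subset[OF D])
  then have le: "le_Learn \<phi> D' D"
    unfolding le_Learn_iff[OF D' D] by (intro allI exI[of _ "{}"]) auto
  have "\<not> le_Learn \<phi> D D'"
  proof
    assume "le_Learn \<phi> D D'"
    from this[unfolded le_Learn_iff[OF D D'], rule_format, of "i UNIV"]
    obtain U where U: "finite U"
      "\<And>e'. \<lbrakk>U \<subseteq> W \<phi> e'; (e', i UNIV) \<in> D\<rbrakk> \<Longrightarrow> (e', i UNIV) \<in> D'"
      using i[of UNIV] by auto
    \<comment> \<open>Being outside \<open>T\<close>, \<open>N\<close> makes \<open>- {N}\<close>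
      equivalent to \<open>UNIV\<close> under \<open>D\<close>; and since \<open>m N > N\<close>,
      both removed points lie beyond \<open>U\<close>.\<close>
    obtain N where N: "T \<union> U \<subseteq> {..<N}"
      using finite_nat_iff_bounded[of "T \<union> U"] T(1) U(1) by auto
    have W: "W \<phi> (i (- {N, m N})) = - {N, m N}" by (simp add: i)
    have "trans D" using D by (auto simp: R_ce_def elim: equivE)
    moreover have "N \<notin> T" using N by auto
    ultimately have "(i (- {N, m N}), i UNIV) \<in> D"
      using m(2)[of N] single[of N] by (meson transD)
    moreover have "U \<subseteq> - {N, m N}" using N m(1)[of N] by force
    ultimately have "(i (- {N, m N}), i UNIV) \<in> D'" using U(2) W by simp
    \<comment> \<open>An isolated set other than \<open>UNIV\<close> cannot be
      \<open>D'\<close>-equivalent to \<open>UNIV\<close>.\<close>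
    moreover have "- {N, m N} \<in> S" unfolding S_def by blast
    ultimately show False
      using i[of UNIV] W by (auto simp: D'_def isolate_def eq_ce_def)
  qed
  with that D' ED' FD' le show thesis by blast
qed

section \<open>Passage to the order of the hierarchy\<close>

theorem theorem4p9:
  fixes \<phi> :: "nat \<Rightarrow> nat \<Rightarrow> nat option"
  assumes "acceptable_enumeration \<phi>"
  shows "\<not> upper_semilattice (TLH \<phi>) \<and>
    (\<exists>E\<in>R_ce \<phi>. \<exists>F\<in>R_ce \<phi>.
      \<not> (\<exists>m. minimal_in (TLH \<phi>)
              {equiv_Learn \<phi> `` {D} | D. D \<in> R_ce \<phi> \<and> le_Learn \<phi> E D \<and> le_Learn \<phi> F D} m))"
proof -
  define E where "E = kernel_ce \<phi> co_min"
  define F where "F = kernel_ce \<phi> co_fill"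
  have EF: "E \<in> R_ce \<phi>" "F \<in> R_ce \<phi>" by (simp_all add: E_def F_def kernel_ce_in_R_ce)
  define B where
    "B = {equiv_Learn \<phi> `` {D} | D. D \<in> R_ce \<phi> \<and> le_Learn \<phi> E D \<and> le_Learn \<phi> F D}"
  have no_min: "\<not> minimal_in (TLH \<phi>) B b" for b
  proof
    assume b: "minimal_in (TLH \<phi>) B b"
    then obtain D where D: "b = equiv_Learn \<phi> `` {D}" "D \<in> R_ce \<phi>" "le_Learn \<phi> E D" "le_Learn \<phi> F D"
      by (auto simp: minimal_in_def B_def)
    obtain D' where D': "D' \<in> R_ce \<phi>" "le_Learn \<phi> E D'" "le_Learn \<phi> F D'"
      "le_Learn \<phi> D' D" "\<not> le_Learn \<phi> D D'"
      using smaller_upper_bound[OF assms D(2)] D(3,4) unfolding E_def F_def by blast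
    have le: "equiv_Learn \<phi> `` {D'} \<sqsubseteq>\<^bsub>TLH \<phi>\<^esub> b"
      "\<not> b \<sqsubseteq>\<^bsub>TLH \<phi>\<^esub> equiv_Learn \<phi> `` {D'}"
      using D(1,2) D'(1,4,5) by (simp_all add: le_TLH_iff)
    then have "equiv_Learn \<phi> `` {D'} \<sqsubset>\<^bsub>TLH \<phi>\<^esub> b"
      by (auto simp: lless_def TLH_def)
    moreover have "equiv_Learn \<phi> `` {D'} \<in> B" using D' by (auto simp: B_def)
    ultimately show False using b by (auto simp: minimal_in_def)
  qed
  \<comment> \<open>A supremum of the two classes would be a least element of \<open>B\<close>, and
    by antisymmetry a minimal one.\<close>
  moreover have "\<not> upper_semilattice (TLH \<phi>)"
  proof
    assume "upper_semilattice (TLH \<phi>)"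
    then interpret upper_semilattice "TLH \<phi>" .
    have EF_carr: "equiv_Learn \<phi> `` {E} \<in> carrier (TLH \<phi>)" "equiv_Learn \<phi> `` {F} \<in> carrier (TLH \<phi>)"
      using EF unfolding carrier_TLH by blast+
    have "b \<in> B \<longleftrightarrow> b \<in> carrier (TLH \<phi>) \<and> equiv_Learn \<phi> `` {E} \<sqsubseteq>\<^bsub>TLH \<phi>\<^esub> b \<and> equiv_Learn \<phi> `` {F} \<sqsubseteq>\<^bsub>TLH \<phi>\<^esub> b"
      for b
      unfolding B_def carrier_TLH mem_Collect_eq using EF le_TLH_iff by metis
    then have B_iff: "b \<in> B \<longleftrightarrow> b \<in> Upper (TLH \<phi>) {equiv_Learn \<phi> `` {E}, equiv_Learn \<phi> `` {F}}"
      for b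
      unfolding Upper_def using EF_carr by blast
    from sup_of_two_exists[OF EF_carr] obtain s where
      s: "least (TLH \<phi>) s (Upper (TLH \<phi>) {equiv_Learn \<phi> `` {E}, equiv_Learn \<phi> `` {F}})" ..
    have carr: "b \<in> carrier (TLH \<phi>)" if "b \<in> B" for b
      using that unfolding B_def carrier_TLH by blast
    have sB: "s \<in> B" and low: "\<And>b. b \<in> B \<Longrightarrow> s \<sqsubseteq>\<^bsub>TLH \<phi>\<^esub> b"
      using s B_iff by (auto simp: least_def)
    have "minimal_in (TLH \<phi>) B s"
      unfolding minimal_in_def
    proof (intro conjI notI)
      assume "\<exists>d\<in>B. d \<sqsubset>\<^bsub>TLH \<phi>\<^esub> s"
      then obtain d where d: "d \<in> B" "d \<sqsubseteq>\<^bsub>TLH \<phi>\<^esub> s" "\<not> d .=\<^bsub>TLH \<phi>\<^esub> s"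
        by (auto simp: lless_def)
      then show False using le_antisym[OF d(2) low] carr sB by blast
    qed (rule sB)
    with no_min show False by blast
  qed
  ultimately show ?thesis using EF unfolding B_def by blast
qed

end
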